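(* Let $\mathcal{B}$ be a real Banach space having a pre-dual space $\mathcal{B}_*$, and let $B_0$ be the closed unit ball of $\mathcal{B}$ centered at the origin. Then for every $\nu\in\mathcal{B}_*\setminus\{0\}$, $$\mathrm{ext}\bigl(\partial\|\cdot\|_{\mathcal{B}_*}(\nu)\bigr)\subset\mathrm{ext}(B_0).$$
   Context: A Banach space $\mathcal{B}$ has a pre-dual space $\mathcal{B}_*$ if $\mathcal{B}_*$ is a Banach space with $(\mathcal{B}_* )^*=\mathcal{B}$ (isometric identification). The subdifferential $\partial\|\cdot\|_{\mathcal{B}_*}(\nu)\subset(\mathcal{B}_* )^*=\mathcal{B}$ is the set of $f\in\mathcal{B}$ with $\|\mu\|_{\mathcal{B}_*}-\|\nu\|_{\mathcal{B}_*}\ge\langle f,\mu-\nu\rangle_{\mathcal{B}_*}$ for all $\mu\in\mathcal{B}_*$. $\mathrm{ext}(A)$ denotes the set of extreme points of a convex set $A$. *)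

theory Defs
  imports "HOL-Analysis.Analysis"
begin

text \<open>
  A Banach space \<open>'b\<close> has the Banach space \<open>'a\<close> as pre-dual if \<open>'b\<close> is isometrically identified
  with the continuous dual of \<open>'a\<close>, i.e. with \<open>'a \<Rightarrow>\<^sub>L real\<close> under the operator norm. The
  identification \<open>J\<close> is kept explicit; the duality pairing of \<open>f :: 'b\<close> with \<open>\<mu> :: 'a\<close> is then
  \<open>blinfun_apply (J f) \<mu>\<close>.
\<close>

definition dual_identification :: "('b::banach \<Rightarrow> ('a::banach \<Rightarrow>\<^sub>L real)) \<Rightarrow> bool" where
  "dual_identification J \<longleftrightarrow> linear J \<and> (\<forall>f. norm (J f) = norm f) \<and> surj J"

definition subdifferential ::
    "('b::banach \<Rightarrow> ('a::banach \<Rightarrow>\<^sub>L real)) \<Rightarrow> ('a \<Rightarrow> real) \<Rightarrow> 'a \<Rightarrow> 'b set" where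
  "subdifferential J \<phi> \<nu> = {f. \<forall>\<mu>. \<phi> \<mu> - \<phi> \<nu> \<ge> blinfun_apply (J f) (\<mu> - \<nu>)}"

definition ext :: "'v::real_vector set \<Rightarrow> 'v set" where
  "ext A = {x. x extreme_point_of A}"

end

theory Submission
  imports Defs
begin

text \<open>
  The subdifferential of a norm at \<open>\<nu>\<close> consists of the functionals of norm at most \<open>1\<close> that attain
  the value \<open>\<parallel>\<nu>\<parallel>\<close> at \<open>\<nu>\<close>. Since \<open>\<parallel>\<nu>\<parallel>\<close> is an upper bound for \<open>f \<mapsto> \<langle>f, \<nu>\<rangle>\<close> on the dual unit ball, this
  is the set where a linear functional attains such a bound on the ball, hence a face of the ball
  (\<open>subdifferential_norm_face_of\<close>). An extreme point of a face of a convex set is an extreme point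
  of the whole set.
\<close>

text \<open>
  If a convex combination of two values \<open>\<le> c\<close> with positive weights equals \<open>c\<close>, then both values
  equal \<open>c\<close>.
\<close>

lemma face_of_linear_maximum:
  fixes l :: "'v::real_vector \<Rightarrow> real"
  assumes "linear l" and "convex S" and le: "\<And>x. x \<in> S \<Longrightarrow> l x \<le> c"
  shows "{x \<in> S. l x = c} face_of S"
  unfolding face_of_def
proof (intro conjI ballI impI)
  interpret linear l by fact
  show "{x \<in> S. l x = c} \<subseteq> S" by blast
  have "convex (l -` {c})"
    using \<open>linear l\<close> by (rule convex_linear_vimage) simp
  then have "convex (S \<inter> l -` {c})"
    using \<open>convex S\<close> by (intro convex_Int)
  moreover have "{x \<in> S. l x = c} = S \<inter> l -` {c}" by auto
  ultimately show "convex {x \<in> S. l x = c}" by simp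
  fix a b x
  assume a: "a \<in> S" and b: "b \<in> S" and x: "x \<in> {x \<in> S. l x = c}"
    and "x \<in> open_segment a b"
  then obtain u where u: "0 < u" "u < 1" "x = (1 - u) *\<^sub>R a + u *\<^sub>R b"
    by (auto simp: in_segment)
  have "(1 - u) * (c - l a) + u * (c - l b) = 0"
  proof -
    have "l x = (1 - u) * l a + u * l b"
      unfolding u(3) by (simp only: add scale real_scaleR_def)
    then show ?thesis using x by (simp add: algebra_simps)
  qed
  moreover have "(1 - u) * (c - l a) \<ge> 0" "u * (c - l b) \<ge> 0"
    using u le[OF a] le[OF b] by simp_all
  ultimately have "(1 - u) * (c - l a) = 0" "u * (c - l b) = 0" by linarith+
  then have "l a = c" "l b = c" using u by auto
  with a b show "a \<in> {x \<in> S. l x = c}" "b \<in> {x \<in> S. l x = c}" by auto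
qed

text \<open>
  Testing the subgradient inequality at \<open>\<nu> + \<mu>\<close> bounds the functional by the norm through the
  triangle inequality; testing it at \<open>0\<close> makes the value at \<open>\<nu>\<close> as large as this bound permits.
\<close>

lemma subgradient_norm_iff:
  fixes g :: "'a::real_normed_vector \<Rightarrow>\<^sub>L real"
  shows "(\<forall>\<mu>. norm \<mu> - norm \<nu> \<ge> blinfun_apply g (\<mu> - \<nu>)) \<longleftrightarrow>
    norm g \<le> 1 \<and> blinfun_apply g \<nu> = norm \<nu>"
proof
  assume sub: "\<forall>\<mu>. norm \<mu> - norm \<nu> \<ge> blinfun_apply g (\<mu> - \<nu>)"
  have upper: "blinfun_apply g \<mu> \<le> norm \<mu>" for \<mu>
    using sub[rule_format, of "\<nu> + \<mu>"] norm_triangle_ineq[of \<nu> \<mu>] by simp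
  have "norm (blinfun_apply g \<mu>) \<le> 1 * norm \<mu>" for \<mu>
    using upper[of \<mu>] upper[of "- \<mu>"] by (simp add: blinfun.minus_right)
  then have "norm g \<le> 1" by (intro norm_blinfun_bound) simp_all
  moreover have "blinfun_apply g \<nu> \<ge> norm \<nu>"
    using sub[rule_format, of 0] by (simp add: blinfun.minus_right)
  ultimately show "norm g \<le> 1 \<and> blinfun_apply g \<nu> = norm \<nu>"
    using upper[of \<nu>] by simp
next
  assume g: "norm g \<le> 1 \<and> blinfun_apply g \<nu> = norm \<nu>"
  have "blinfun_apply g \<mu> \<le> norm \<mu>" for \<mu>
    using norm_blinfun[of g \<mu>] mult_right_mono[of "norm g" 1 "norm \<mu>"] g by auto
  with g show "\<forall>\<mu>. norm \<mu> - norm \<nu> \<ge> blinfun_apply g (\<mu> - \<nu>)"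
    by (simp add: blinfun.diff_right)
qed

lemma subdifferential_norm_eq:
  assumes "dual_identification J"
  shows "subdifferential J norm \<nu> = {f \<in> cball 0 1. blinfun_apply (J f) \<nu> = norm \<nu>}"
  using assms
  by (simp add: subdifferential_def subgradient_norm_iff dual_identification_def)

lemma subdifferential_norm_face_of:
  assumes "dual_identification J"
  shows "subdifferential J norm \<nu> face_of cball 0 1"
  unfolding subdifferential_norm_eq[OF assms]
proof (rule face_of_linear_maximum)
  interpret linear J using assms by (simp add: dual_identification_def)
  show "linear (\<lambda>f. blinfun_apply (J f) \<nu>)"
    by (rule linearI) (simp_all add: add scale blinfun.add_left blinfun.scaleR_left)
  show "blinfun_apply (J f) \<nu> \<le> norm \<nu>" if "f \<in> cball 0 1" for f
  proof -
    have "norm (J f) \<le> 1" using assms that by (simp add: dual_identification_def)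
    then show ?thesis
      using norm_blinfun[of "J f" \<nu>] mult_right_mono[of "norm (J f)" 1 "norm \<nu>"] by auto
  qed
qed (rule convex_cball)

theorem proposition35:
  fixes J :: "'b::banach \<Rightarrow> ('a::banach \<Rightarrow>\<^sub>L real)"
    and \<nu> :: 'a
  assumes "dual_identification J"
    and "\<nu> \<noteq> 0"
  shows "ext (subdifferential J norm \<nu>) \<subseteq> ext (cball (0::'b) 1)"
  using extreme_point_of_face[OF subdifferential_norm_face_of[OF assms(1), of \<nu>]]
  by (auto simp: ext_def)

end
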